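(* Let $V=\{1,\ldots,n\}$, let $X_1,\ldots,X_n$ be continuous random variables with joint density $f_{\mathbf X}$, and let $(V,\Gamma,\mathcal S)$ be an acyclic hypergraph with an associated junction tree. Suppose that $f_{\mathbf X}$ is a junction tree probability distribution, i.e. \[ f_{\mathbf X}(\mathbf x)=\frac{\prod_{K\in\Gamma} f_{\mathbf X_K}(\mathbf x_K)}{\prod_{S\in\mathcal S}\left[f_{\mathbf X_S}(\mathbf x_S)\right]^{v_S-1}}, \] where $f_{\mathbf X_K}$, $f_{\mathbf X_S}$ are the marginal densities of $f_{\mathbf X}$ and $v_S$ is the number of those clusters which contain all the variables of $\mathbf X_S$. Then the copula density associated to this distribution is given by \[ c_{\mathbf X}(\mathbf u_V)=\frac{\prod_{K\in\Gamma} c_{\mathbf X_K}(\mathbf u_K)}{\prod_{S\in\mathcal S}\left[c_{\mathbf X_S}(\mathbf u_S)\right]^{v_S-1}}, \] where $u_i=F_{X_i}(x_i)$ for $i=1,\ldots,n$ (the identity being understood at points $\mathbf x$ where the densities appearing in denominators are positive).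
   Context: Acyclic hypergraph: $\Gamma$ is a set of subsets (clusters) of $V$ with $\bigcup_{K\in\Gamma}K=V$, no element of $\Gamma$ is a subset of another element, and the elements of $\Gamma$ can be ordered $(K_1,\ldots,K_m)$ with the running intersection property: for every $j\ge 2$ there is $i<j$ with $K_i\supseteq K_j\cap(K_1\cup\cdots\cup K_{j-1})$. The separator sets are $S_j=K_j\cap(K_1\cup\cdots\cup K_{j-1})$, with $S_1=\emptyset$; $\mathcal S$ denotes the set of separators. For $S\in\mathcal S$, $v_S$ is the number of clusters $K\in\Gamma$ such that $X_K$ contains all the variables of $X_S$, i.e. with $S\subseteq K$. Densities and copula densities indexed by the empty set are taken to be $1$. Junction tree: a tree whose nodes (clusters) are the subsets $X_K=\{X_i: i\in K\}$, $K\in\Gamma$, of $X=\{X_1,\ldots,X_n\}$, each with its marginal density $f_{\mathbf X_K}$, and whose edges connecting two clusters (separators) consist of subsets $X_S$, $S$ a separator set, each with its marginal density $f_{\mathbf X_S}$; the union of all clusters is $X$; and if two clusters contain a random variable, then all clusters on the path between them contain this variable. Notation: for $D=\{i_1,\ldots,i_d\}\subseteq V$, $\mathbf X_D=(X_{i_1},\ldots,X_{i_d})^T$, $\mathbf x_D=(x_{i_1},\ldots,x_{i_d})^T$; $F_{X_i}$ and $f_{X_i}$ are the univariate marginal cdf and density of $X_i$ (assumed to exist); $F_{\mathbf X_D}$, $f_{\mathbf X_D}$ are the joint cdf and density of $\mathbf X_D$; $\mathbf u_D=(F_{X_{i_1}}(x_{i_1}),\ldots,F_{X_{i_d}}(x_{i_d}))^T$.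 $C_{\mathbf X_D}$ is the copula of $\mathbf X_D$ given by Sklar's theorem, $F_{\mathbf X_D}(\mathbf x_D)=C_{\mathbf X_D}(\mathbf u_D)$, and $c_{\mathbf X_D}=\partial^d C_{\mathbf X_D}/\partial u_{i_1}\cdots\partial u_{i_d}$ is its copula density; $c_{\mathbf X}=c_{\mathbf X_V}$. The densities are assumed to exist and to satisfy $f_{\mathbf X_D}(\mathbf x_D)=c_{\mathbf X_D}(\mathbf u_D)\prod_{i\in D}f_{X_i}(x_i)$, so that, where the univariate densities are positive, $c_{\mathbf X_D}(\mathbf u_D)=f_{\mathbf X_D}(\mathbf x_D)/\prod_{i\in D}f_{X_i}(x_i)$.
   Formalization: With v_S the number of clusters containing S, it is assumed that no nonempty separator lies properly inside another (the claim fails otherwise); for general acyclic hypergraphs it is proved with v_S − 1 replaced by the number of junction tree edges carrying S. *)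

theory Defs
  imports "HOL-Probability.Probability"
begin

section \<open>Acyclic hypergraphs and junction trees\<close>

definition running_intersection :: "'v set list \<Rightarrow> bool" where
  "running_intersection Ks \<longleftrightarrow>
     (\<forall>j<length Ks. 0 < j \<longrightarrow> (\<exists>i<j. Ks ! j \<inter> \<Union>(set (take j Ks)) \<subseteq> Ks ! i))"

text \<open>Indices are shifted by one; the value for the first cluster (index 0) is the empty set.\<close>

definition separator :: "'v set list \<Rightarrow> nat \<Rightarrow> 'v set" where
  "separator Ks j = Ks ! j \<inter> \<Union>(set (take j Ks))"

definition acyclic_hypergraph :: "'v set \<Rightarrow> 'v set set \<Rightarrow> 'v set set \<Rightarrow> bool" where
  "acyclic_hypergraph V \<Gamma> \<S> \<longleftrightarrow>
     \<Union>\<Gamma> = V \<and>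
     (\<forall>K\<in>\<Gamma>. \<forall>L\<in>\<Gamma>. \<not> K \<subset> L) \<and>
     (\<exists>Ks. distinct Ks \<and> set Ks = \<Gamma> \<and> running_intersection Ks \<and>
           \<S> = {separator Ks j |j. j < length Ks})"

definition tree_path :: "'c set \<Rightarrow> 'c set set \<Rightarrow> 'c \<Rightarrow> 'c list \<Rightarrow> 'c \<Rightarrow> bool" where
  "tree_path N E K p L \<longleftrightarrow>
     p \<noteq> [] \<and> hd p = K \<and> last p = L \<and> distinct p \<and> set p \<subseteq> N \<and>
     successively (\<lambda>A B. {A, B} \<in> E) p"

definition undirected_tree :: "'c set \<Rightarrow> 'c set set \<Rightarrow> bool" where
  "undirected_tree N E \<longleftrightarrow>
     (\<forall>e\<in>E. \<exists>K\<in>N. \<exists>L\<in>N. K \<noteq> L \<and> e = {K, L}) \<and>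
     (\<forall>K\<in>N. \<forall>L\<in>N. \<exists>!p. tree_path N E K p L)"

text \<open>The nodes are the clusters; an edge \<open>{K, L}\<close> carries the separator
  \<open>\<Inter>{K, L} = K \<inter> L\<close>.\<close>

definition junction_tree ::
    "'v set \<Rightarrow> 'v set set \<Rightarrow> 'v set set \<Rightarrow> 'v set set set \<Rightarrow> bool" where
  "junction_tree V \<Gamma> \<S> E \<longleftrightarrow>
     undirected_tree \<Gamma> E \<and>
     \<Union>\<Gamma> = V \<and>
     (\<forall>e\<in>E. \<Inter>e \<in> \<S>) \<and>
     (\<forall>K\<in>\<Gamma>. \<forall>L\<in>\<Gamma>. \<forall>p. tree_path \<Gamma> E K p L \<longrightarrow> (\<forall>Q\<in>set p. K \<inter> L \<subseteq> Q))"

definition clusters_containing :: "'v set set \<Rightarrow> 'v set \<Rightarrow> nat" where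
  "clusters_containing \<Gamma> S = card {K \<in> \<Gamma>. S \<subseteq> K}"

text \<open>Removing the edges that carry \<open>S\<close> cuts the subtree of the clusters containing \<open>S\<close>
  into this many pieces.  For a nonempty separator \<open>S\<close> it is equal to
  \<open>clusters_containing \<Gamma> S\<close> iff no separator properly contains \<open>S\<close>; otherwise it is
  strictly smaller.\<close>

definition pieces_joined_by :: "'v set set set \<Rightarrow> 'v set \<Rightarrow> nat" where
  "pieces_joined_by E S = card {e \<in> E. \<Inter>e = S} + 1"

text \<open>The empty separator is exempt, since it only contributes a factor 1.\<close>

definition unnested :: "'v set set \<Rightarrow> bool" where
  "unnested \<S> \<longleftrightarrow> (\<forall>S\<in>\<S>. \<forall>T\<in>\<S>. S \<noteq> {} \<longrightarrow> \<not> S \<subset> T)"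

definition cluster_quotient ::
    "'v set set \<Rightarrow> 'v set set \<Rightarrow> ('v set \<Rightarrow> nat) \<Rightarrow> ('v set \<Rightarrow> real) \<Rightarrow> real" where
  "cluster_quotient \<Gamma> \<S> v g = (\<Prod>K\<in>\<Gamma>. g K) / (\<Prod>S\<in>\<S>. g S ^ (v S - 1))"

text \<open>Vectors indexed by \<open>D\<close> are extensional functions, so \<open>restrict x D\<close> is the
  subvector of \<open>x\<close> with indices in \<open>D\<close>.\<close>

definition junction_tree_density ::
    "'v set \<Rightarrow> 'v set set \<Rightarrow> 'v set set \<Rightarrow> ('v set \<Rightarrow> nat) \<Rightarrow>
      ('v set \<Rightarrow> ('v \<Rightarrow> real) \<Rightarrow> real) \<Rightarrow> bool" where
  "junction_tree_density V \<Gamma> \<S> v f \<longleftrightarrow>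
     (\<forall>x. (\<forall>S\<in>\<S>. 0 < f S (restrict x S)) \<longrightarrow>
        f V (restrict x V) = cluster_quotient \<Gamma> \<S> v (\<lambda>D. f D (restrict x D)))"

section \<open>Copulas and copula densities\<close>

definition is_copula :: "'v set \<Rightarrow> (('v \<Rightarrow> real) \<Rightarrow> real) \<Rightarrow> bool" where
  "is_copula D C \<longleftrightarrow>
     (\<exists>\<mu>. prob_space \<mu> \<and> sets \<mu> = sets (\<Pi>\<^sub>M i\<in>D. (borel :: real measure)) \<and>
        (\<forall>i\<in>D. distr \<mu> borel (\<lambda>w. w i) = uniform_measure lborel {0..1}) \<and>
        (\<forall>u \<in> D \<rightarrow>\<^sub>E {0..1}. C u = measure \<mu> {w \<in> space \<mu>. \<forall>i\<in>D. w i \<le> u i}))"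

definition univariate_transform ::
    "'a measure \<Rightarrow> ('v \<Rightarrow> 'a \<Rightarrow> real) \<Rightarrow> 'v set \<Rightarrow> ('v \<Rightarrow> real) \<Rightarrow> 'v \<Rightarrow> real" where
  "univariate_transform M X D x = (\<lambda>i\<in>D. cdf (distr M borel (X i)) (x i))"

definition copula_of ::
    "'a measure \<Rightarrow> ('v \<Rightarrow> 'a \<Rightarrow> real) \<Rightarrow> 'v set \<Rightarrow> (('v \<Rightarrow> real) \<Rightarrow> real) \<Rightarrow> bool" where
  "copula_of M X D C \<longleftrightarrow> is_copula D C \<and>
     (\<forall>x. measure M {\<omega> \<in> space M. \<forall>i\<in>D. X i \<omega> \<le> x i} = C (univariate_transform M X D x))"

text \<open>Partial derivatives are taken within the domain \<open>[0,1]\<close> of each argument (hence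
  one-sided at 0 and 1); the head of the list is the variable of the outermost derivative.\<close>

fun mixed_partial :: "'v list \<Rightarrow> (('v \<Rightarrow> real) \<Rightarrow> real) \<Rightarrow> ('v \<Rightarrow> real) \<Rightarrow> real" where
  "mixed_partial [] C u = C u"
| "mixed_partial (i # is) C u =
     vector_derivative (\<lambda>t. mixed_partial is C (u(i := t))) (at (u i) within {0..1})"

fun mixed_partial_exists :: "'v list \<Rightarrow> (('v \<Rightarrow> real) \<Rightarrow> real) \<Rightarrow> ('v \<Rightarrow> real) \<Rightarrow> bool" where
  "mixed_partial_exists [] C u \<longleftrightarrow> True"
| "mixed_partial_exists (i # is) C u \<longleftrightarrow>
     mixed_partial_exists is C u \<and>
     (\<forall>\<^sub>F t in at (u i) within {0..1}. mixed_partial_exists is C (u(i := t))) \<and>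
     (\<lambda>t. mixed_partial is C (u(i := t))) differentiable (at (u i) within {0..1})"

text \<open>\<open>C D\<close> is the copula of the subvector with indices in \<open>D\<close>.\<close>

definition copula_density ::
    "('v::linorder set \<Rightarrow> ('v \<Rightarrow> real) \<Rightarrow> real) \<Rightarrow> 'v set \<Rightarrow> ('v \<Rightarrow> real) \<Rightarrow> real" where
  "copula_density C D u =
     (if D = {} then 1 else mixed_partial (sorted_list_of_set D) (C D) u)"

end

theory Submission
  imports Defs
begin

text \<open>Substituting \<open>f\<^sub>D = c\<^sub>D \<Prod>i\<in>D. f\<^sub>i\<close> into the junction tree factorization, each univariate
  density \<open>f\<^sub>i\<close> occurs in the numerator once for every cluster containing \<open>i\<close>, and in the
  denominator once for every edge whose separator contains \<open>i\<close>. These clusters and edges form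
  a subtree of the junction tree, so exactly one factor \<open>f\<^sub>i\<close> survives. If no nonempty separator
  is nested in another one, then the edges carrying \<open>S\<close> are all the edges of the subtree of
  clusters containing \<open>S\<close>, so that both multiplicities agree.\<close>

section \<open>Counting edges in trees and subtrees\<close>

lemma undirected_tree_edge:
  assumes "undirected_tree N E" and "e \<in> E"
  obtains A B where "A \<in> N" and "B \<in> N" and "A \<noteq> B" and "e = {A, B}"
  using conjunct1[OF assms(1)[unfolded undirected_tree_def]] assms(2) by (meson that)

lemma undirected_tree_path:
  assumes "undirected_tree N E" and "K \<in> N" and "L \<in> N"
  shows "\<exists>!p. tree_path N E K p L"
  by (rule bspec[OF bspec[OF conjunct2[OF assms(1)[unfolded undirected_tree_def]]]]) (use assms in auto)

text \<open>Root the tree at some \<open>r\<close>. Sending each other node to the first edge on its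
  path to \<open>r\<close> is a bijection onto the edges, so only the root is left without an
  edge.\<close>

lemma card_undirected_tree:
  assumes tree: "undirected_tree N E" and "finite N" and "N \<noteq> {}"
  shows "card N = card E + 1"
proof -
  obtain r where r: "r \<in> N" using \<open>N \<noteq> {}\<close> by blast
  have uniq: "\<exists>!p. tree_path N E K p r" if "K \<in> N" for K
    by (rule undirected_tree_path[OF tree that r])
  define P where "P K = (THE p. tree_path N E K p r)" for K
  have P: "tree_path N E K (P K) r" if "K \<in> N" for K
    unfolding P_def by (rule theI'[OF uniq[OF that]])
  have P_eq: "P K = p" if "tree_path N E K p r" for K p
  proof -
    have "K \<in> N" using that unfolding tree_path_def by (metis hd_in_set subsetD)
    then show ?thesis using uniq P that by blast
  qed
  \<comment> \<open>By uniqueness of paths, the tail of the path from \<open>K\<close> to the root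
    is itself the chosen path of the next node.\<close>
  have step: "\<exists>q. P K = K # q \<and> P (hd q) = q \<and> q \<noteq> [] \<and> hd q \<in> N \<and> {K, hd q} \<in> E \<and> K \<notin> set q"
    if K: "K \<in> N - {r}" for K
  proof -
    have pk: "tree_path N E K (P K) r" using P K by blast
    then obtain q where q: "P K = K # q" unfolding tree_path_def by (metis list.collapse)
    have q0: "q \<noteq> []" using pk K q unfolding tree_path_def by auto
    then have "tree_path N E (hd q) q r" and "hd q \<in> N" "{K, hd q} \<in> E" "K \<notin> set q"
      using pk q unfolding tree_path_def by (auto simp: successively_Cons)
    then show ?thesis using q q0 P_eq by blast
  qed
  \<comment> \<open>The second node of \<open>P K\<close> is the parent of \<open>K\<close>, so
    \<open>h K\<close> is its parent edge.\<close>
  define h where "h K = {K, hd (tl (P K))}" for K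
  have first_edge: "{A, B} \<in> h ` (N - {r})"
    if "A \<in> N" "tree_path N E A (A # B # q) r" for A B q
  proof -
    have "P A = A # B # q" using that P_eq by blast
    moreover have "A \<noteq> r" using that(2) unfolding tree_path_def
      by (metis distinct.simps(2) last_ConsR last_in_set list.distinct(1))
    ultimately show ?thesis using that(1) unfolding h_def by (intro image_eqI[of _ _ A]) auto
  qed
  have "bij_betw h (N - {r}) E"
    unfolding bij_betw_def
  proof
    show "inj_on h (N - {r})"
    proof (rule inj_onI, rule ccontr)
      \<comment> \<open>Two distinct nodes with the same parent edge would be parents of each other,
        so \<open>K\<close> would occur again later on its own path.\<close>
      fix K L assume K: "K \<in> N - {r}" and L: "L \<in> N - {r}" and eq: "h K = h L" and ne: "K \<noteq> L"
      obtain q where q: "P K = K # q" "P (hd q) = q" "q \<noteq> []" "K \<notin> set q" using step[OF K] by blast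
      obtain q' where q': "P L = L # q'" "q' \<noteq> []" using step[OF L] by blast
      have "hd q = L" "hd q' = K" using eq ne q(1) q'(1) unfolding h_def by (auto simp: doubleton_eq_iff)
      then have "q = L # q'" and "K \<in> set q'" using q q' hd_in_set by force+
      then show False using q(4) by simp
    qed
    show "h ` (N - {r}) = E"
    proof
      show "h ` (N - {r}) \<subseteq> E"
        using step unfolding h_def by fastforce
      show "E \<subseteq> h ` (N - {r})"
      proof
        fix e assume "e \<in> E"
        then obtain A B where AB: "A \<in> N" "B \<in> N" "A \<noteq> B" "e = {A, B}"
          by (rule undirected_tree_edge[OF tree])
        then have ed: "{A, B} \<in> E" "{B, A} \<in> E" using \<open>e \<in> E\<close> by (auto simp: insert_commute)
        have pa: "tree_path N E A (P A) r" using P AB by blast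
        then obtain p where p: "P A = A # p" unfolding tree_path_def by (metis list.collapse)
        \<comment> \<open>One end of the edge must be the parent of the other. If \<open>B\<close>
          lies on the path of \<open>A\<close>, cutting out what precedes \<open>B\<close> gives a
          path A, B, ..., which uniqueness identifies with \<open>P A\<close>. Otherwise putting
          \<open>B\<close> in front gives the path of \<open>B\<close>.\<close>
        show "e \<in> h ` (N - {r})"
        proof (cases "B \<in> set p")
          case True
          then obtain ys zs where p': "p = ys @ B # zs" by (metis split_list)
          have "tree_path N E B (B # zs) r" "tree_path N E A (A # B # zs) r"
            using pa p p' ed AB unfolding tree_path_def
            by (auto simp: successively_Cons successively_append_iff)
          then show ?thesis using first_edge[of A B zs] AB by blast
        next
          case False
          then have "tree_path N E B (B # A # p) r"
            using pa p ed AB unfolding tree_path_def by auto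
          then show ?thesis using first_edge[of B A p] p AB by (metis insert_commute)
        qed
      qed
    qed
  qed
  then have "card (N - {r}) = card E" by (rule bij_betw_same_card)
  then show ?thesis using r \<open>finite N\<close> by (metis Suc_eq_plus1 card.remove)
qed

text \<open>Between nodes of \<open>N'\<close> the induced subgraph has exactly the same paths as
  the whole tree, so existence and uniqueness are inherited.\<close>

lemma undirected_tree_convex_subset:
  assumes tree: "undirected_tree N E" and "N' \<subseteq> N"
    and convex: "\<And>K L p. K \<in> N' \<Longrightarrow> L \<in> N' \<Longrightarrow> tree_path N E K p L \<Longrightarrow> set p \<subseteq> N'"
  shows "undirected_tree N' {e \<in> E. e \<subseteq> N'}"
proof -
  have path_iff: "tree_path N' {e \<in> E. e \<subseteq> N'} K p L \<longleftrightarrow> tree_path N E K p L"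
    if KL: "K \<in> N'" "L \<in> N'" for K p L
  proof -
    have "successively (\<lambda>A B. {A, B} \<in> {e \<in> E. e \<subseteq> N'}) p \<longleftrightarrow> successively (\<lambda>A B. {A, B} \<in> E) p"
      if "set p \<subseteq> N'"
      using that by (intro successively_cong) auto
    moreover have "set p \<subseteq> N'" if "tree_path N E K p L"
      using convex KL that by blast
    ultimately show ?thesis using \<open>N' \<subseteq> N\<close> unfolding tree_path_def by blast
  qed
  have "\<exists>K\<in>N'. \<exists>L\<in>N'. K \<noteq> L \<and> e = {K, L}" if e: "e \<in> {e \<in> E. e \<subseteq> N'}" for e
  proof -
    have "e \<in> E" using e by blast
    then obtain K L where "K \<noteq> L" "e = {K, L}" by (rule undirected_tree_edge[OF tree])
    then show ?thesis using e by blast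
  qed
  moreover have "\<exists>!p. tree_path N' {e \<in> E. e \<subseteq> N'} K p L" if "K \<in> N'" "L \<in> N'" for K L
    unfolding path_iff[OF that]
    by (rule undirected_tree_path[OF tree]) (use \<open>N' \<subseteq> N\<close> that in auto)
  ultimately show ?thesis unfolding undirected_tree_def by (intro conjI ballI)
qed

section \<open>Multiplicities of separators and of single variables\<close>

text \<open>The path condition of a junction tree says that the clusters containing \<open>S\<close>
  form a convex set, hence a subtree, to which the count of edges applies. The cluster
  \<open>K\<close> makes this subtree nonempty.\<close>

lemma junction_tree_clusters_containing:
  assumes tree: "junction_tree V \<Gamma> \<S> E" and "finite \<Gamma>" and "K \<in> \<Gamma>" and "S \<subseteq> K"
  shows "clusters_containing \<Gamma> S = card {e \<in> E. S \<subseteq> \<Inter>e} + 1"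
proof -
  let ?N = "{K \<in> \<Gamma>. S \<subseteq> K}"
  have "set p \<subseteq> ?N" if "K \<in> ?N" "L \<in> ?N" "tree_path \<Gamma> E K p L" for K L p
  proof -
    have "K \<inter> L \<subseteq> Q" if "Q \<in> set p" for Q
      using tree \<open>K \<in> ?N\<close> \<open>L \<in> ?N\<close> \<open>tree_path \<Gamma> E K p L\<close> that unfolding junction_tree_def by blast
    moreover have "set p \<subseteq> \<Gamma>" using that unfolding tree_path_def by blast
    ultimately show ?thesis using that by blast
  qed
  moreover have "undirected_tree \<Gamma> E" using tree unfolding junction_tree_def by blast
  ultimately have "undirected_tree ?N {e \<in> E. e \<subseteq> ?N}"
    by (intro undirected_tree_convex_subset[of \<Gamma>]) auto
  then have "card ?N = card {e \<in> E. e \<subseteq> ?N} + 1"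
    using assms(2-) by (intro card_undirected_tree) auto
  \<comment> \<open>An edge lies in the subtree iff both its ends contain \<open>S\<close>, that is,
    iff their intersection does.\<close>
  moreover have "e \<subseteq> ?N \<longleftrightarrow> S \<subseteq> \<Inter>e" if "e \<in> E" for e
  proof -
    have "e \<subseteq> \<Gamma>" using undirected_tree_edge[OF \<open>undirected_tree \<Gamma> E\<close> that] by blast
    then show ?thesis by blast
  qed
  then have "{e \<in> E. e \<subseteq> ?N} = {e \<in> E. S \<subseteq> \<Inter>e}" by blast
  ultimately show ?thesis unfolding clusters_containing_def by simp
qed

lemma junction_tree_finite_edges:
  assumes "junction_tree V \<Gamma> \<S> E" and "finite \<Gamma>"
  shows "finite E"
proof (rule finite_subset)
  have "undirected_tree \<Gamma> E" using assms(1) unfolding junction_tree_def by blast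
  then show "E \<subseteq> Pow \<Gamma>" by (blast elim: undirected_tree_edge)
qed (use assms in simp)

lemma clusters_containing_eq_pieces_joined_by:
  assumes tree: "junction_tree V \<Gamma> \<S> E" and "finite \<Gamma>" and "unnested \<S>"
    and "S \<in> \<S>" and "S \<noteq> {}" and "K \<in> \<Gamma>" and "S \<subseteq> K"
  shows "clusters_containing \<Gamma> S = pieces_joined_by E S"
proof -
  have "S \<subseteq> \<Inter>e \<longleftrightarrow> \<Inter>e = S" if "e \<in> E" for e
  proof -
    have "\<Inter>e \<in> \<S>" using tree that unfolding junction_tree_def by blast
    then show ?thesis using assms unfolding unnested_def by blast
  qed
  then have "{e \<in> E. S \<subseteq> \<Inter>e} = {e \<in> E. \<Inter>e = S}" by blast
  then show ?thesis
    using junction_tree_clusters_containing[OF assms(1,2,6,7)] unfolding pieces_joined_by_def by simp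
qed

text \<open>This is the subtree count for the singleton of \<open>i\<close>, with the edges grouped
  by the separator they carry. It says that \<open>i\<close> occurs exactly once more among the
  clusters than among the separators with multiplicity.\<close>

lemma junction_tree_vertex_count:
  assumes tree: "junction_tree V \<Gamma> \<S> E" and "finite \<Gamma>" and "finite \<S>" and "i \<in> V"
  shows "card {K \<in> \<Gamma>. i \<in> K} = (\<Sum>S | S \<in> \<S> \<and> i \<in> S. pieces_joined_by E S - 1) + 1"
proof -
  obtain K where "K \<in> \<Gamma>" "{i} \<subseteq> K" using assms unfolding junction_tree_def by blast
  then have "card {K \<in> \<Gamma>. i \<in> K} = card {e \<in> E. i \<in> \<Inter>e} + 1"
    using junction_tree_clusters_containing[OF assms(1,2), of K "{i}"]
    unfolding clusters_containing_def by simp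
  also have "{e \<in> E. i \<in> \<Inter>e} = (\<Union>S \<in> {S \<in> \<S>. i \<in> S}. {e \<in> E. \<Inter>e = S})"
    using tree unfolding junction_tree_def by auto
  also have "card \<dots> = (\<Sum>S | S \<in> \<S> \<and> i \<in> S. card {e \<in> E. \<Inter>e = S})"
    using assms junction_tree_finite_edges[OF assms(1,2)] by (intro card_UN_disjoint) auto
  finally show ?thesis unfolding pieces_joined_by_def by simp
qed

text \<open>Double counting of the incidences of \<open>i\<close> and \<open>K\<close>. The weight
  \<open>w\<close> lets one statement serve both the clusters (weight 1) and the separators (weight
  multiplicity minus 1).\<close>

lemma prod_subset_swap:
  fixes p :: "'v \<Rightarrow> 'r::comm_semiring_1"
  assumes "finite V" and "finite A" and "\<And>K. K \<in> A \<Longrightarrow> K \<subseteq> V"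
  shows "(\<Prod>K\<in>A. (\<Prod>i\<in>K. p i) ^ w K) = (\<Prod>i\<in>V. p i ^ (\<Sum>K | K \<in> A \<and> i \<in> K. w K))"
proof -
  have "(\<Prod>K\<in>A. (\<Prod>i\<in>K. p i) ^ w K) = (\<Prod>K\<in>A. \<Prod>i | i \<in> V \<and> i \<in> K. p i ^ w K)"
  proof (rule prod.cong[OF refl])
    fix K assume "K \<in> A"
    then have "{i. i \<in> V \<and> i \<in> K} = K" using assms(3) by blast
    then show "(\<Prod>i\<in>K. p i) ^ w K = (\<Prod>i | i \<in> V \<and> i \<in> K. p i ^ w K)"
      by (simp add: prod_power_distrib)
  qed
  also have "\<dots> = (\<Prod>i\<in>V. \<Prod>K | K \<in> A \<and> i \<in> K. p i ^ w K)"
    using assms by (intro prod.swap_restrict) auto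
  finally show ?thesis by (simp add: power_sum)
qed

section \<open>Transfer of the factorization from densities to copula densities\<close>

text \<open>This also holds where a denominator vanishes, since division by zero yields
  zero.\<close>

lemma cluster_quotient_mult:
  "cluster_quotient \<Gamma> \<S> v (\<lambda>D. g D * h D) = cluster_quotient \<Gamma> \<S> v g * cluster_quotient \<Gamma> \<S> v h"
  unfolding cluster_quotient_def by (simp add: prod.distrib power_mult_distrib)

lemma cluster_quotient_prod:
  assumes tree: "junction_tree V \<Gamma> \<S> E" and "finite V" and "\<And>S. S \<in> \<S> \<Longrightarrow> S \<subseteq> V"
    and "\<And>i. i \<in> V \<Longrightarrow> p i \<noteq> 0"
  shows "cluster_quotient \<Gamma> \<S> (pieces_joined_by E) (\<lambda>D. \<Prod>i\<in>D. p i) = (\<Prod>i\<in>V. p i)"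
proof -
  have sub: "\<And>K. K \<in> \<Gamma> \<Longrightarrow> K \<subseteq> V" using tree unfolding junction_tree_def by blast
  have fin: "finite \<Gamma>" "finite \<S>"
    using sub assms(2,3) by (auto intro: finite_subset[of _ "Pow V"])
  \<comment> \<open>\<open>?w i\<close> is the exponent of \<open>p i\<close> in the denominator; in
    the numerator the exponent is \<open>?w i + 1\<close>.\<close>
  let ?w = "\<lambda>i. \<Sum>S | S \<in> \<S> \<and> i \<in> S. pieces_joined_by E S - 1"
  have "(\<Prod>K\<in>\<Gamma>. \<Prod>i\<in>K. p i) = (\<Prod>i\<in>V. p i ^ card {K \<in> \<Gamma>. i \<in> K})"
    using prod_subset_swap[OF assms(2) fin(1) sub, of p "\<lambda>_. 1"] by simp
  also have "\<dots> = (\<Prod>i\<in>V. p i) * (\<Prod>i\<in>V. p i ^ ?w i)"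
    using junction_tree_vertex_count[OF tree fin] by (simp add: prod.distrib)
  finally have "(\<Prod>K\<in>\<Gamma>. \<Prod>i\<in>K. p i) = (\<Prod>i\<in>V. p i) * (\<Prod>i\<in>V. p i ^ ?w i)" .
  moreover have "(\<Prod>S\<in>\<S>. (\<Prod>i\<in>S. p i) ^ (pieces_joined_by E S - 1)) = (\<Prod>i\<in>V. p i ^ ?w i)"
    using prod_subset_swap[OF assms(2) fin(2) assms(3)] by simp
  moreover have "(\<Prod>i\<in>V. p i ^ ?w i) \<noteq> 0" using assms by simp
  ultimately show ?thesis unfolding cluster_quotient_def by simp
qed

lemma acyclic_hypergraph_separator_subset:
  assumes "acyclic_hypergraph V \<Gamma> \<S>" and "S \<in> \<S>"
  obtains K where "K \<in> \<Gamma>" and "S \<subseteq> K"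
proof -
  obtain Ks j where "set Ks = \<Gamma>" "j < length Ks" "S = separator Ks j"
    using assms unfolding acyclic_hypergraph_def by blast
  then show thesis using that[of "Ks ! j"] unfolding separator_def by auto
qed

theorem theorem1:
  fixes M :: "'a measure"
    and X :: "nat \<Rightarrow> 'a \<Rightarrow> real"
    and n :: nat
    and V :: "nat set"
    and \<Gamma> \<S> :: "nat set set"
    and E :: "nat set set set"
    and f C :: "nat set \<Rightarrow> (nat \<Rightarrow> real) \<Rightarrow> real"
  assumes M: "prob_space M"
    and V: "V = {1..n}"
    and hypergraph: "acyclic_hypergraph V \<Gamma> \<S>"
    and tree: "junction_tree V \<Gamma> \<S> E"
    and f_nonneg: "\<And>D x. D \<subseteq> V \<Longrightarrow> 0 \<le> f D x"
    and f_empty: "\<And>x. f {} x = 1"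
    and f_density: "\<And>D. D \<subseteq> V \<Longrightarrow> D \<noteq> {} \<Longrightarrow>
      distributed M (\<Pi>\<^sub>M i\<in>D. lborel) (\<lambda>\<omega>. \<lambda>i\<in>D. X i \<omega>) (\<lambda>x. ennreal (f D x))"
    and copula: "\<And>D. D \<subseteq> V \<Longrightarrow> D \<noteq> {} \<Longrightarrow> copula_of M X D (C D)"
    and copula_density_exists: "\<And>D x. D \<subseteq> V \<Longrightarrow> D \<noteq> {} \<Longrightarrow>
      \<forall>i\<in>D. 0 < f {i} (restrict x {i}) \<Longrightarrow>
      mixed_partial_exists (sorted_list_of_set D) (C D) (univariate_transform M X D x)"
    and density_eq: "\<And>D x. D \<subseteq> V \<Longrightarrow> D \<noteq> {} \<Longrightarrow>
      \<forall>i\<in>D. 0 < f {i} (restrict x {i}) \<Longrightarrow>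
      f D (restrict x D) =
        copula_density C D (univariate_transform M X D x) * (\<Prod>i\<in>D. f {i} (restrict x {i}))"
  shows "(unnested \<S> \<and> junction_tree_density V \<Gamma> \<S> (clusters_containing \<Gamma>) f \<longrightarrow>
      (\<forall>x. (\<forall>i\<in>V. 0 < f {i} (restrict x {i})) \<and> (\<forall>S\<in>\<S>. 0 < f S (restrict x S)) \<longrightarrow>
        copula_density C V (univariate_transform M X V x) =
          cluster_quotient \<Gamma> \<S> (clusters_containing \<Gamma>)
            (\<lambda>D. copula_density C D (univariate_transform M X D x)))) \<and>
    (junction_tree_density V \<Gamma> \<S> (pieces_joined_by E) f \<longrightarrow>
      (\<forall>x. (\<forall>i\<in>V. 0 < f {i} (restrict x {i})) \<and> (\<forall>S\<in>\<S>. 0 < f S (restrict x S)) \<longrightarrow>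
        copula_density C V (univariate_transform M X V x) =
          cluster_quotient \<Gamma> \<S> (pieces_joined_by E)
            (\<lambda>D. copula_density C D (univariate_transform M X D x))))"
proof -
  have sep: "\<exists>K\<in>\<Gamma>. S \<subseteq> K" if "S \<in> \<S>" for S
    using acyclic_hypergraph_separator_subset[OF hypergraph that] by blast
  have cluster: "K \<subseteq> V" if "K \<in> \<Gamma>" for K
    using tree that unfolding junction_tree_def by blast
  have sep_V: "S \<subseteq> V" if "S \<in> \<S>" for S using sep cluster that by blast
  have fin_V: "finite V" using V by simp
  then have fin: "finite V" "finite \<Gamma>"
    using cluster by (auto intro: finite_subset[of _ "Pow V"])
  define c where "c x D = copula_density C D (univariate_transform M X D x)" for x D
  have pieces: "c x V = cluster_quotient \<Gamma> \<S> (pieces_joined_by E) (c x)"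
    if jt: "junction_tree_density V \<Gamma> \<S> (pieces_joined_by E) f"
      and pos: "\<forall>i\<in>V. 0 < f {i} (restrict x {i})" and "\<forall>S\<in>\<S>. 0 < f S (restrict x S)" for x
  proof -
    let ?p = "\<lambda>i. f {i} (restrict x {i})"
    \<comment> \<open>The identity must include the empty set, because the first separator of the
      ordering is empty. There both densities are 1 by convention.\<close>
    have eq: "f D (restrict x D) = c x D * (\<Prod>i\<in>D. ?p i)" if "D \<subseteq> V" for D
    proof (cases "D = {}")
      case True
      then show ?thesis by (simp add: f_empty c_def copula_density_def)
    next
      case False
      then show ?thesis using density_eq[of D x] that pos unfolding c_def by blast
    qed
    have "c x V * (\<Prod>i\<in>V. ?p i) =
        cluster_quotient \<Gamma> \<S> (pieces_joined_by E) (\<lambda>D. f D (restrict x D))"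
      using jt that(3) eq[of V] unfolding junction_tree_density_def by simp
    also have "\<dots> = cluster_quotient \<Gamma> \<S> (pieces_joined_by E) (\<lambda>D. c x D * (\<Prod>i\<in>D. ?p i))"
      unfolding cluster_quotient_def using eq cluster sep_V by simp
    also have "\<dots> = cluster_quotient \<Gamma> \<S> (pieces_joined_by E) (c x) * (\<Prod>i\<in>V. ?p i)"
    proof -
      have "cluster_quotient \<Gamma> \<S> (pieces_joined_by E) (\<lambda>D. \<Prod>i\<in>D. ?p i) = (\<Prod>i\<in>V. ?p i)"
        using pos by (intro cluster_quotient_prod[OF tree fin(1) sep_V]) auto
      then show ?thesis by (simp add: cluster_quotient_mult)
    qed
    \<comment> \<open>The product of the univariate densities is positive and cancels.\<close>
    finally show ?thesis using pos fin by (force simp: prod_zero_iff)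
  qed
  \<comment> \<open>The two multiplicities can differ only at the empty separator, where the base of
    the power is 1.\<close>
  have same_quotient: "cluster_quotient \<Gamma> \<S> (clusters_containing \<Gamma>) g =
      cluster_quotient \<Gamma> \<S> (pieces_joined_by E) g"
    if "unnested \<S>" and "g {} = 1" for g
  proof -
    have "g S ^ (clusters_containing \<Gamma> S - 1) = g S ^ (pieces_joined_by E S - 1)" if "S \<in> \<S>" for S
    proof (cases "S = {}")
      case False
      then show ?thesis
        using clusters_containing_eq_pieces_joined_by[OF tree fin(2) \<open>unnested \<S>\<close> that] sep[OF that]
        by auto
    qed (simp add: \<open>g {} = 1\<close>)
    then show ?thesis unfolding cluster_quotient_def by simp
  qed
  have c_empty: "c x {} = 1" for x by (simp add: c_def copula_density_def)
  \<comment> \<open>\<open>same_quotient\<close> is used twice: here for \<open>f\<close>, to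
    translate the hypothesis, and at the end for \<open>c x\<close>, to translate the conclusion
    back.\<close>
  have unnested_density: "junction_tree_density V \<Gamma> \<S> (clusters_containing \<Gamma>) f \<longleftrightarrow>
      junction_tree_density V \<Gamma> \<S> (pieces_joined_by E) f" if "unnested \<S>"
    unfolding junction_tree_density_def by (simp add: same_quotient that f_empty)
  show ?thesis
    unfolding c_def[symmetric]
  proof (intro conjI impI allI)
    fix x
    assume nested: "unnested \<S> \<and> junction_tree_density V \<Gamma> \<S> (clusters_containing \<Gamma>) f"
      and pos: "(\<forall>i\<in>V. 0 < f {i} (restrict x {i})) \<and> (\<forall>S\<in>\<S>. 0 < f S (restrict x S))"
    then have "c x V = cluster_quotient \<Gamma> \<S> (pieces_joined_by E) (c x)"
      by (intro pieces) (use unnested_density in auto)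
    then show "c x V = cluster_quotient \<Gamma> \<S> (clusters_containing \<Gamma>) (c x)"
      using same_quotient c_empty nested by simp
  qed (use pieces in blast)
qed

end
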